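(* Let $\mathcal B_1,\mathcal B_2$ be countable sets with distinguished subsets $\mathbf{ex}_i\subseteq\mathcal B_i$ ($i=1,2$) and let $\phi\colon\mathcal B_1^0\to\mathcal B_2^0$ be $\mathbf{ex}$-admissible. There is a functor $\mathbf F\colon\mathcal E(\mathbf{ex}_1,\mathcal B_1)\to\mathcal E(\mathbf{ex}_2,\mathcal B_2)$ defined on objects $\underline k\in\mathcal K(\mathbf{ex}_1,\mathcal B_1)$ by $\mathbf F\underline k=F\underline k$ and on the morphisms $\vec\mu_k\colon\underline k\to(k,\underline k)$ by $$\mathbf F\vec\mu_k=\begin{cases}\vec\mu_{\phi_{\underline k}(k)}&\text{if }\phi_{\underline k}(k)\in\mu_{F\underline k}(\mathbf{ex}_2),\\ \mathrm{id}_{F\underline k}&\text{if }\phi_{\underline k}(k)=0.\end{cases}$$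
   Context: For a set $\mathcal B$ with $\mathbf{ex}\subseteq\mathcal B$ and $k\in\mathbf{ex}$, let $\mu_{\mathcal B}(k)$ be a new element not in $\mathcal B$, and put $\mu_k(\mathcal B)=(\mathcal B\setminus\{k\})\cup\{\mu_{\mathcal B}(k)\}$, $\mu_k(\mathbf{ex})=(\mathbf{ex}\setminus\{k\})\cup\{\mu_{\mathcal B}(k)\}$. There is a bijection $\mu_k\colon\mathcal B\to\mu_k(\mathcal B)$ fixing $b\ne k$ and sending $k$ to $\mu_{\mathcal B}(k)$. Iterating, $\mathcal K(\mathbf{ex},\mathcal B)$ is the set of $(\mathbf{ex},\mathcal B)$-admissible sequences: tuples $\underline k=(k_r,\dots,k_1)$, including $()$, with $k_i\in\mu_{k_{i-1}}(\cdots(\mu_{k_1}(\mathbf{ex})))$ for all $i$; $\mu_{\underline k}(\mathcal B)=\mu_{k_r}(\cdots\mu_{k_1}(\mathcal B))$, similarly $\mu_{\underline k}(\mathbf{ex})$; and $\mu_{\underline k}\colon\mathcal B\to\mu_{\underline k}(\mathcal B)$ is the composite bijection. For a set $S$ not containing the symbol $0$, $S^0=S\sqcup\{0\}$; $\mu^0_{\underline k}\colon\mathcal B^0\to\mu_{\underline k}(\mathcal B)^0$ extends $\mu_{\underline k}$ by $0\mapsto0$. The directed exchange tree $E(\mathbf{ex},\mathcal B)$ has vertex set $\mathcal K(\mathbf{ex},\mathcal B)$ and an arrow $\vec\mu_k\colon\underline k\to(k,\underline k)$ for each $k\in\mu_{\underline k}(\mathbf{ex})$; $\mathcal E(\mathbf{ex},\mathcal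 B)$ is its (ordinary) path category. $\phi\colon\mathcal B_1^0\to\mathcal B_2^0$ is $\mathbf{ex}$-admissible if $\phi(0)=0$ and $\phi(\mathbf{ex}_1)\subseteq\mathbf{ex}_2^0$. Given such $\phi$, define for $\underline k\in\mathcal K(\mathbf{ex}_1,\mathcal B_1)$, recursively on the length $r$: $F()=()$, $\phi_{()}=\phi$; for $r\ge1$ and $\underline k'=(k_{r-1},\dots,k_1)$, $F\underline k=(\phi_{\underline k'}(k_r),F\underline k')$ if $\phi_{\underline k'}(k_r)\in\mu_{F\underline k'}(\mathbf{ex}_2)$ and $F\underline k=F\underline k'$ if $\phi_{\underline k'}(k_r)=0$; and $\phi_{\underline k}\colon\mu_{\underline k}(\mathcal B_1)^0\to\mu_{F\underline k}(\mathcal B_2)^0$, $\phi_{\underline k}=\mu^0_{F\underline k}\circ\phi\circ(\mu^0_{\underline k})^{-1}$. (One has $F\underline k\in\mathcal K(\mathbf{ex}_2,\mathcal B_2)$ and $\phi_{\underline k}(\mu_{\underline k}(\mathbf{ex}_1))\subseteq\mu_{F\underline k}(\mathbf{ex}_2)^0$.) *)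

theory Defs
  imports
    "HOL-Library.Countable_Set"
    "HOL-Library.FuncSet"
    "Graph_Theory.Arc_Walk"
begin

section \<open>Categories, functors, path categories\<close>

text \<open>Composition is written in the usual order: \<open>Comp C g f\<close> is "g after f".\<close>

record ('o, 'm) cat =
  Obj :: "'o set"
  Mor :: "'m set"
  Dom :: "'m \<Rightarrow> 'o"
  Cod :: "'m \<Rightarrow> 'o"
  Ident :: "'o \<Rightarrow> 'm"
  Comp :: "'m \<Rightarrow> 'm \<Rightarrow> 'm"

locale is_category =
  fixes C :: "('o, 'm) cat"
  assumes Dom_in: "f \<in> Mor C \<Longrightarrow> Dom C f \<in> Obj C"
    and Cod_in: "f \<in> Mor C \<Longrightarrow> Cod C f \<in> Obj C"
    and Ident_in: "x \<in> Obj C \<Longrightarrow> Ident C x \<in> Mor C"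
    and Dom_Ident: "x \<in> Obj C \<Longrightarrow> Dom C (Ident C x) = x"
    and Cod_Ident: "x \<in> Obj C \<Longrightarrow> Cod C (Ident C x) = x"
    and Comp_in: "\<lbrakk>f \<in> Mor C; g \<in> Mor C; Cod C f = Dom C g\<rbrakk> \<Longrightarrow> Comp C g f \<in> Mor C"
    and Dom_Comp: "\<lbrakk>f \<in> Mor C; g \<in> Mor C; Cod C f = Dom C g\<rbrakk> \<Longrightarrow> Dom C (Comp C g f) = Dom C f"
    and Cod_Comp: "\<lbrakk>f \<in> Mor C; g \<in> Mor C; Cod C f = Dom C g\<rbrakk> \<Longrightarrow> Cod C (Comp C g f) = Cod C g"
    and Comp_Ident_left: "f \<in> Mor C \<Longrightarrow> Comp C (Ident C (Cod C f)) f = f"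
    and Comp_Ident_right: "f \<in> Mor C \<Longrightarrow> Comp C f (Ident C (Dom C f)) = f"
    and Comp_assoc: "\<lbrakk>f \<in> Mor C; g \<in> Mor C; h \<in> Mor C; Cod C f = Dom C g; Cod C g = Dom C h\<rbrakk>
      \<Longrightarrow> Comp C h (Comp C g f) = Comp C (Comp C h g) f"

locale is_functor = C: is_category C + D: is_category D
  for C :: "('o, 'm) cat" and D :: "('p, 'n) cat" +
  fixes Fo :: "'o \<Rightarrow> 'p" and Fm :: "'m \<Rightarrow> 'n"
  assumes Fo_in: "x \<in> Obj C \<Longrightarrow> Fo x \<in> Obj D"
    and Fm_in: "f \<in> Mor C \<Longrightarrow> Fm f \<in> Mor D"
    and Fm_Dom: "f \<in> Mor C \<Longrightarrow> Dom D (Fm f) = Fo (Dom C f)"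
    and Fm_Cod: "f \<in> Mor C \<Longrightarrow> Cod D (Fm f) = Fo (Cod C f)"
    and Fm_Ident: "x \<in> Obj C \<Longrightarrow> Fm (Ident C x) = Ident D (Fo x)"
    and Fm_Comp: "\<lbrakk>f \<in> Mor C; g \<in> Mor C; Cod C f = Dom C g\<rbrakk>
      \<Longrightarrow> Fm (Comp C g f) = Comp D (Fm g) (Fm f)"

text \<open>A morphism is a finite directed path \<open>(u, p, v)\<close> from \<open>u\<close> to \<open>v\<close>, where \<open>p\<close> lists
  the arcs in the order in which they are traversed.\<close>

definition path_category :: "('v, 'e) pre_digraph \<Rightarrow> ('v, 'v \<times> 'e list \<times> 'v) cat" where
  "path_category G =
    \<lparr> Obj = verts G,
      Mor = {(u, p, v). pre_digraph.awalk G u p v},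
      Dom = (\<lambda>(u, p, v). u),
      Cod = (\<lambda>(u, p, v). v),
      Ident = (\<lambda>u. (u, [], u)),
      Comp = (\<lambda>(v', q, w) (u, p, v). (u, p @ q, w)) \<rparr>"

definition arc_path :: "('v, 'e) pre_digraph \<Rightarrow> 'e \<Rightarrow> 'v \<times> 'e list \<times> 'v" where
  "arc_path G e = (tail G e, [e], head G e)"


section \<open>Mutation of sets and admissible sequences\<close>

text \<open>
  The choice of new elements is a function \<open>\<nu>\<close>: the element \<open>\<mu>\<^sub>B(k)\<close> is \<open>\<nu> B k\<close>.
  That it does not lie in \<open>B\<close> is required by \<open>fresh_choice\<close> below.
  A sequence \<open>(k\<^sub>r, \<dots>, k\<^sub>1)\<close> is the list \<open>[k\<^sub>r, \<dots>, k\<^sub>1]\<close>; the mutation performed last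
  is the head of the list.
\<close>

definition mutate :: "('a set \<Rightarrow> 'a \<Rightarrow> 'a) \<Rightarrow> 'a set \<Rightarrow> 'a \<Rightarrow> 'a set \<Rightarrow> 'a set" where
  "mutate \<nu> B k S = (S - {k}) \<union> {\<nu> B k}"

text \<open>For \<open>S \<subseteq> B\<close>, the set \<open>\<mu>\<^bsub>ks\<^esub>(S)\<close>, with new elements chosen relative to \<open>B\<close> and its
  mutations. It is used for \<open>S = B\<close> and for \<open>S = ex\<close>.\<close>

fun mut_set :: "('a set \<Rightarrow> 'a \<Rightarrow> 'a) \<Rightarrow> 'a set \<Rightarrow> 'a list \<Rightarrow> 'a set \<Rightarrow> 'a set" where
  "mut_set \<nu> B [] S = S"
| "mut_set \<nu> B (k # ks) S = mutate \<nu> (mut_set \<nu> B ks B) k (mut_set \<nu> B ks S)"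

fun mut_map :: "('a set \<Rightarrow> 'a \<Rightarrow> 'a) \<Rightarrow> 'a set \<Rightarrow> 'a list \<Rightarrow> 'a \<Rightarrow> 'a" where
  "mut_map \<nu> B [] = id"
| "mut_map \<nu> B (k # ks) = id(k := \<nu> (mut_set \<nu> B ks B) k) \<circ> mut_map \<nu> B ks"

inductive_set admissible_seqs :: "('a set \<Rightarrow> 'a \<Rightarrow> 'a) \<Rightarrow> 'a set \<Rightarrow> 'a set \<Rightarrow> 'a list set"
  for \<nu> :: "'a set \<Rightarrow> 'a \<Rightarrow> 'a" and ex :: "'a set" and B :: "'a set" where
  empty_seq: "[] \<in> admissible_seqs \<nu> ex B"
| extend_seq: "\<lbrakk>ks \<in> admissible_seqs \<nu> ex B; k \<in> mut_set \<nu> B ks ex\<rbrakk>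
    \<Longrightarrow> k # ks \<in> admissible_seqs \<nu> ex B"

text \<open>
  No function can satisfy \<open>\<nu> B k \<notin> B\<close> for all sets \<open>B\<close> over a HOL type (take \<open>B = UNIV\<close>).
  Newness is therefore required exactly where elements are actually chosen: for the sets
  reached from \<open>B\<close> by admissible sequences of mutations. This is implied by newness for
  all countable sets, but is also satisfiable over countable types.
\<close>

definition fresh_choice :: "('a set \<Rightarrow> 'a \<Rightarrow> 'a) \<Rightarrow> 'a set \<Rightarrow> 'a set \<Rightarrow> bool" where
  "fresh_choice \<nu> ex B \<longleftrightarrow>
    (\<forall>ks \<in> admissible_seqs \<nu> ex B. \<forall>k \<in> mut_set \<nu> B ks ex.
      \<nu> (mut_set \<nu> B ks B) k \<notin> mut_set \<nu> B ks B)"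

text \<open>The set \<open>S\<^sup>0\<close>: the symbol \<open>0\<close> is \<open>None\<close>, an element \<open>s\<close> of \<open>S\<close> is \<open>Some s\<close>.\<close>

definition adj0 :: "'a set \<Rightarrow> 'a option set" where
  "adj0 S = insert None (Some ` S)"

definition mut_map0 :: "('a set \<Rightarrow> 'a \<Rightarrow> 'a) \<Rightarrow> 'a set \<Rightarrow> 'a list \<Rightarrow> 'a option \<Rightarrow> 'a option" where
  "mut_map0 \<nu> B ks = map_option (mut_map \<nu> B ks)"


section \<open>The directed exchange tree\<close>

text \<open>The arc \<open>(k, ks)\<close> is the arrow from \<open>ks\<close> to \<open>k # ks\<close>.\<close>

definition exchange_tree ::
  "('a set \<Rightarrow> 'a \<Rightarrow> 'a) \<Rightarrow> 'a set \<Rightarrow> 'a set \<Rightarrow> ('a list, 'a \<times> 'a list) pre_digraph" where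
  "exchange_tree \<nu> ex B =
    \<lparr> verts = admissible_seqs \<nu> ex B,
      arcs = {(k, ks). ks \<in> admissible_seqs \<nu> ex B \<and> k \<in> mut_set \<nu> B ks ex},
      tail = (\<lambda>(k, ks). ks),
      head = (\<lambda>(k, ks). k # ks) \<rparr>"

abbreviation exchange_category ::
  "('a set \<Rightarrow> 'a \<Rightarrow> 'a) \<Rightarrow> 'a set \<Rightarrow> 'a set
    \<Rightarrow> ('a list, 'a list \<times> ('a \<times> 'a list) list \<times> 'a list) cat" where
  "exchange_category \<nu> ex B \<equiv> path_category (exchange_tree \<nu> ex B)"

text \<open>The morphism \<open>ks \<rightarrow> k # ks\<close> of the exchange category given by the arrow of \<open>k\<close>.\<close>

definition mut_arrow ::
  "('a set \<Rightarrow> 'a \<Rightarrow> 'a) \<Rightarrow> 'a set \<Rightarrow> 'a set \<Rightarrow> 'a \<Rightarrow> 'a list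
    \<Rightarrow> 'a list \<times> ('a \<times> 'a list) list \<times> 'a list" where
  "mut_arrow \<nu> ex B k ks = arc_path (exchange_tree \<nu> ex B) (k, ks)"


section \<open>Admissible maps and the induced map on sequences\<close>

definition ex_admissible ::
  "'a set \<Rightarrow> 'a set \<Rightarrow> 'b set \<Rightarrow> 'b set \<Rightarrow> ('a option \<Rightarrow> 'b option) \<Rightarrow> bool" where
  "ex_admissible ex1 B1 ex2 B2 \<phi> \<longleftrightarrow>
    \<phi> \<in> adj0 B1 \<rightarrow> adj0 B2 \<and> \<phi> None = None \<and> \<phi> ` Some ` ex1 \<subseteq> adj0 ex2"

text \<open>\<open>conj_map \<nu>1 B1 \<nu>2 B2 \<phi> ks ls\<close> is \<open>\<mu>\<^sup>0\<^bsub>ls\<^esub> \<circ> \<phi> \<circ> (\<mu>\<^sup>0\<^bsub>ks\<^esub>)\<^sup>-\<^sup>1\<close>; for \<open>ls = F ks\<close> this is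
  the map \<open>\<phi>\<^bsub>ks\<^esub>\<close>, called \<open>phi_seq\<close> below.\<close>

definition conj_map ::
  "('a set \<Rightarrow> 'a \<Rightarrow> 'a) \<Rightarrow> 'a set \<Rightarrow> ('b set \<Rightarrow> 'b \<Rightarrow> 'b) \<Rightarrow> 'b set
    \<Rightarrow> ('a option \<Rightarrow> 'b option) \<Rightarrow> 'a list \<Rightarrow> 'b list \<Rightarrow> 'a option \<Rightarrow> 'b option" where
  "conj_map \<nu>1 B1 \<nu>2 B2 \<phi> ks ls =
    mut_map0 \<nu>2 B2 ls \<circ> \<phi> \<circ> inv_into (adj0 B1) (mut_map0 \<nu>1 B1 ks)"

text \<open>The last branch does not occur for admissible \<open>\<phi>\<close> and admissible sequences.\<close>

fun F_seq ::
  "('a set \<Rightarrow> 'a \<Rightarrow> 'a) \<Rightarrow> 'a set \<Rightarrow> ('b set \<Rightarrow> 'b \<Rightarrow> 'b) \<Rightarrow> 'b set \<Rightarrow> 'b set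
    \<Rightarrow> ('a option \<Rightarrow> 'b option) \<Rightarrow> 'a list \<Rightarrow> 'b list" where
  "F_seq \<nu>1 B1 \<nu>2 ex2 B2 \<phi> [] = []"
| "F_seq \<nu>1 B1 \<nu>2 ex2 B2 \<phi> (k # ks) =
    (let ls = F_seq \<nu>1 B1 \<nu>2 ex2 B2 \<phi> ks;
         y = conj_map \<nu>1 B1 \<nu>2 B2 \<phi> ks ls (Some k)
     in if y \<in> Some ` mut_set \<nu>2 B2 ls ex2 then the y # ls
        else if y = None then ls
        else undefined)"

definition phi_seq ::
  "('a set \<Rightarrow> 'a \<Rightarrow> 'a) \<Rightarrow> 'a set \<Rightarrow> ('b set \<Rightarrow> 'b \<Rightarrow> 'b) \<Rightarrow> 'b set \<Rightarrow> 'b set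
    \<Rightarrow> ('a option \<Rightarrow> 'b option) \<Rightarrow> 'a list \<Rightarrow> 'a option \<Rightarrow> 'b option" where
  "phi_seq \<nu>1 B1 \<nu>2 ex2 B2 \<phi> ks =
    conj_map \<nu>1 B1 \<nu>2 B2 \<phi> ks (F_seq \<nu>1 B1 \<nu>2 ex2 B2 \<phi> ks)"

end

theory Submission
  imports Defs
begin

text \<open>
  The exchange category is the free category on the exchange tree, so a functor out of it is
  determined by sending each arc to an arbitrary path between the images of its ends: here the
  path of length one given by the arrow of \<open>\<phi>\<^bsub>ks\<^esub>(k)\<close>, or the empty path if \<open>\<phi>\<^bsub>ks\<^esub>(k) = 0\<close>.
  One of the two cases always applies: newness makes \<open>\<mu>\<^bsub>ks\<^esub>\<close> injective, hence every
  \<open>k \<in> \<mu>\<^bsub>ks\<^esub>(ex1)\<close> is \<open>\<mu>\<^bsub>ks\<^esub>(e)\<close> for a unique \<open>e \<in> B1\<close>, which lies in \<open>ex1\<close>, and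
  \<open>\<phi>\<^bsub>ks\<^esub>(k) = \<mu>\<^sup>0\<^bsub>F ks\<^esub>(\<phi>(e))\<close>.
\<close>

lemma path_category_simps [simp]:
  "Obj (path_category G) = verts G"
  "(u, p, v) \<in> Mor (path_category G) \<longleftrightarrow> pre_digraph.awalk G u p v"
  "Dom (path_category G) (u, p, v) = u"
  "Cod (path_category G) (u, p, v) = v"
  "Ident (path_category G) u = (u, [], u)"
  "Comp (path_category G) (v', q, w) (u, p, v) = (u, p @ q, w)"
  by (simp_all add: path_category_def)

lemma (in wf_digraph) is_category_path_category: "is_category (path_category G)"
proof
  fix f assume f: "f \<in> Mor (path_category G)"
  show "Dom (path_category G) f \<in> Obj (path_category G)"
    using f by (cases f) auto
  show "Cod (path_category G) f \<in> Obj (path_category G)"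
    using f by (cases f) auto
  show "Comp (path_category G) (Ident (path_category G) (Cod (path_category G) f)) f = f"
    by (cases f) simp
  show "Comp (path_category G) f (Ident (path_category G) (Dom (path_category G) f)) = f"
    by (cases f) simp
  fix g assume g: "g \<in> Mor (path_category G)"
    "Cod (path_category G) f = Dom (path_category G) g"
  show "Comp (path_category G) g f \<in> Mor (path_category G)"
    using f g by (cases f, cases g) (auto intro: awalk_appendI)
  show "Dom (path_category G) (Comp (path_category G) g f) = Dom (path_category G) f"
    by (cases f, cases g) simp
  show "Cod (path_category G) (Comp (path_category G) g f) = Cod (path_category G) g"
    by (cases f, cases g) simp
  fix h
  show "Comp (path_category G) h (Comp (path_category G) g f)
      = Comp (path_category G) (Comp (path_category G) h g) f"
    by (cases f, cases g, cases h) simp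
qed (auto simp: awalk_Nil_iff)

text \<open>Universal property of the free category, with arcs allowed to go to paths of any length,
  even empty. Functoriality comes from \<open>concat\<close> and \<open>map\<close> respecting
  append; the induction along the path only tracks endpoints.\<close>

lemma is_functor_path_category:
  assumes G: "wf_digraph G" and H: "wf_digraph H"
    and f: "\<And>u. u \<in> verts G \<Longrightarrow> f u \<in> verts H"
    and g: "\<And>e. e \<in> arcs G \<Longrightarrow> pre_digraph.awalk H (f (tail G e)) (g e) (f (head G e))"
  shows "is_functor (path_category G) (path_category H) f
    (\<lambda>(u, p, v). (f u, concat (map g p), f v))"
proof -
  interpret G: wf_digraph G by (rule G)
  interpret H: wf_digraph H by (rule H)
  interpret CG: is_category "path_category G" by (rule G.is_category_path_category)
  interpret CH: is_category "path_category H" by (rule H.is_category_path_category)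
  have walk: "H.awalk (f u) (concat (map g p)) (f v)" if "G.awalk u p v" for u p v
    using that
  proof (induction p arbitrary: u)
    case Nil
    then show ?case by (auto simp: G.awalk_Nil_iff H.awalk_Nil_iff f)
  next
    case (Cons e p)
    then show ?case
      \<comment> \<open>The walks are to be joined at \<open>f (head G e)\<close>;
        \<open>awalk_append_iff\<close> would instead name the joint as the last vertex of
        \<open>g e\<close>.\<close>
      by (auto simp: G.awalk_Cons_iff simp del: H.awalk_append_iff intro: H.awalk_appendI g)
  qed
  show ?thesis
  proof
    fix m n
    assume "m \<in> Mor (path_category G)" "n \<in> Mor (path_category G)"
      "Cod (path_category G) m = Dom (path_category G) n"
    then show "(\<lambda>(u, p, v). (f u, concat (map g p), f v)) (Comp (path_category G) n m) =
        Comp (path_category H) ((\<lambda>(u, p, v). (f u, concat (map g p), f v)) n)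
          ((\<lambda>(u, p, v). (f u, concat (map g p), f v)) m)"
      by (cases m, cases n) simp
  qed (auto simp: f walk)
qed

lemma wf_digraph_exchange_tree: "wf_digraph (exchange_tree \<nu> ex B)"
  by unfold_locales (auto simp: exchange_tree_def intro: admissible_seqs.intros)

lemma mut_set_mono:
  assumes "S \<subseteq> T"
  shows "mut_set \<nu> B ks S \<subseteq> mut_set \<nu> B ks T"
  using assms by (induction ks) (auto simp: mutate_def)

text \<open>Admissibility puts \<open>k\<close> into the current set, so removing \<open>k\<close>
  and inserting the new element is a genuine replacement, as the map performs it. If
  \<open>k\<close> were absent, the set would grow while the map fixed all its points.\<close>

lemma mut_set_eq_image:
  assumes "ks \<in> admissible_seqs \<nu> ex B" and "ex \<subseteq> S"
  shows "mut_set \<nu> B ks S = mut_map \<nu> B ks ` S"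
  using assms(1)
proof induction
  case empty_seq
  then show ?case by simp
next
  case (extend_seq ks k)
  have "k \<in> mut_set \<nu> B ks S"
    using extend_seq.hyps mut_set_mono [OF assms(2)] by blast
  then have "mut_set \<nu> B (k # ks) S = id(k := \<nu> (mut_set \<nu> B ks B) k) ` mut_set \<nu> B ks S"
    by (auto simp: mutate_def image_iff)
  then show ?case
    by (simp only: extend_seq.IH image_comp mut_map.simps)
qed

text \<open>Each step redirects one point to a value outside the image of the previous map, so no
  collision arises.\<close>

lemma inj_on_mut_map:
  assumes "ks \<in> admissible_seqs \<nu> ex B" and "ex \<subseteq> B" and "fresh_choice \<nu> ex B"
  shows "inj_on (mut_map \<nu> B ks) B"
  using assms(1)
proof induction
  case empty_seq
  then show ?case by simp
next
  case (extend_seq ks k)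
  let ?b = "\<nu> (mut_set \<nu> B ks B) k"
  have "?b \<notin> mut_set \<nu> B ks B"
    using assms(3) extend_seq.hyps by (auto simp: fresh_choice_def)
  then have "?b \<notin> mut_map \<nu> B ks ` B"
    by (simp only: mut_set_eq_image [OF extend_seq.hyps(1) assms(2)] not_False_eq_True)
  then have "inj_on (id(k := ?b)) (mut_map \<nu> B ks ` B)"
    by (intro inj_on_fun_updI) simp_all
  with extend_seq.IH show ?case
    unfolding mut_map.simps by (rule comp_inj_on)
qed

lemma conj_map_mut_map:
  assumes "ks \<in> admissible_seqs \<nu>1 ex1 B1" and "ex1 \<subseteq> B1" and "fresh_choice \<nu>1 ex1 B1"
    and "b \<in> B1"
  shows "conj_map \<nu>1 B1 \<nu>2 B2 \<phi> ks ls (Some (mut_map \<nu>1 B1 ks b))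
    = mut_map0 \<nu>2 B2 ls (\<phi> (Some b))"
proof -
  have "inj_on (mut_map0 \<nu>1 B1 ks) (adj0 B1)"
    using inj_on_mut_map [OF assms(1-3)]
    by (auto simp: inj_on_def adj0_def mut_map0_def)
  moreover have "Some b \<in> adj0 B1"
    using assms(4) by (simp add: adj0_def)
  ultimately have "inv_into (adj0 B1) (mut_map0 \<nu>1 B1 ks) (mut_map0 \<nu>1 B1 ks (Some b)) = Some b"
    by (rule inv_into_f_f)
  then show ?thesis
    by (simp add: conj_map_def mut_map0_def)
qed

text \<open>Pull \<open>k\<close> back to \<open>ex1\<close>, apply \<phi>, push forward along
  \<open>ls\<close>. The sequence \<open>ls\<close> is arbitrary so that this applies inside the
  induction showing that \<open>F_seq\<close> yields admissible sequences.\<close>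

lemma conj_map_in_adj0_mut_set:
  assumes "ks \<in> admissible_seqs \<nu>1 ex1 B1" and "ex1 \<subseteq> B1" and "fresh_choice \<nu>1 ex1 B1"
    and "ls \<in> admissible_seqs \<nu>2 ex2 B2" and "ex_admissible ex1 B1 ex2 B2 \<phi>"
    and "k \<in> mut_set \<nu>1 B1 ks ex1"
  shows "conj_map \<nu>1 B1 \<nu>2 B2 \<phi> ks ls (Some k) \<in> adj0 (mut_set \<nu>2 B2 ls ex2)"
proof -
  obtain e where e: "e \<in> ex1" "k = mut_map \<nu>1 B1 ks e"
    using assms(6) mut_set_eq_image [OF assms(1) subset_refl] by blast
  have "conj_map \<nu>1 B1 \<nu>2 B2 \<phi> ks ls (Some k) = mut_map0 \<nu>2 B2 ls (\<phi> (Some e))"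
    using conj_map_mut_map [OF assms(1-3)] e assms(2) by blast
  moreover have "\<phi> (Some e) \<in> adj0 ex2"
    using assms(5) e(1) by (auto simp: ex_admissible_def)
  ultimately show ?thesis
    using mut_set_eq_image [OF assms(4) subset_refl]
    by (auto simp: adj0_def mut_map0_def)
qed

text \<open>The value tested in the recursion lies in \<open>adj0\<close> of the mutated
  \<open>ex2\<close>, which rules out the \<open>undefined\<close> branch.\<close>

lemma F_seq_in_admissible_seqs:
  assumes "ks \<in> admissible_seqs \<nu>1 ex1 B1" and "ex1 \<subseteq> B1" and "fresh_choice \<nu>1 ex1 B1"
    and "ex_admissible ex1 B1 ex2 B2 \<phi>"
  shows "F_seq \<nu>1 B1 \<nu>2 ex2 B2 \<phi> ks \<in> admissible_seqs \<nu>2 ex2 B2"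
  using assms(1)
proof induction
  case empty_seq
  then show ?case by (simp add: admissible_seqs.empty_seq)
next
  case (extend_seq ks k)
  then show ?case
    using conj_map_in_adj0_mut_set [OF extend_seq.hyps(1) assms(2,3) extend_seq.IH assms(4)
        extend_seq.hyps(2)]
    by (auto simp: adj0_def Let_def intro: admissible_seqs.extend_seq)
qed

theorem lemma7p9:
  fixes B1 ex1 :: "'a set" and \<nu>1 :: "'a set \<Rightarrow> 'a \<Rightarrow> 'a"
    and B2 ex2 :: "'b set" and \<nu>2 :: "'b set \<Rightarrow> 'b \<Rightarrow> 'b"
    and \<phi> :: "'a option \<Rightarrow> 'b option"
  assumes "countable B1" and "ex1 \<subseteq> B1" and "fresh_choice \<nu>1 ex1 B1"
    and "countable B2" and "ex2 \<subseteq> B2" and "fresh_choice \<nu>2 ex2 B2"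
    and "ex_admissible ex1 B1 ex2 B2 \<phi>"
  defines "F \<equiv> F_seq \<nu>1 B1 \<nu>2 ex2 B2 \<phi>"
    and "\<phi>' \<equiv> phi_seq \<nu>1 B1 \<nu>2 ex2 B2 \<phi>"
  shows "\<exists>Fo Fm.
    is_functor (exchange_category \<nu>1 ex1 B1) (exchange_category \<nu>2 ex2 B2) Fo Fm \<and>
    (\<forall>ks \<in> admissible_seqs \<nu>1 ex1 B1. Fo ks = F ks) \<and>
    (\<forall>ks \<in> admissible_seqs \<nu>1 ex1 B1. \<forall>k \<in> mut_set \<nu>1 B1 ks ex1.
      \<phi>' ks (Some k) \<in> adj0 (mut_set \<nu>2 B2 (F ks) ex2) \<and>
      (\<forall>l \<in> mut_set \<nu>2 B2 (F ks) ex2. \<phi>' ks (Some k) = Some l \<longrightarrow>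
        Fm (mut_arrow \<nu>1 ex1 B1 k ks) = mut_arrow \<nu>2 ex2 B2 l (F ks)) \<and>
      (\<phi>' ks (Some k) = None \<longrightarrow>
        Fm (mut_arrow \<nu>1 ex1 B1 k ks) = Ident (exchange_category \<nu>2 ex2 B2) (F ks)))"
proof -
  let ?G = "exchange_tree \<nu>1 ex1 B1" and ?H = "exchange_tree \<nu>2 ex2 B2"
  interpret H: wf_digraph ?H by (rule wf_digraph_exchange_tree)
  \<comment> \<open>No membership test is made here: \<open>phi_in\<close> guarantees that
    \<open>l\<close> is mutable whenever \<open>(k, ks)\<close> is an arc.\<close>
  define g where "g = (\<lambda>(k, ks). case \<phi>' ks (Some k) of None \<Rightarrow> [] | Some l \<Rightarrow> [(l, F ks)])"
  define Fm where "Fm = (\<lambda>(u, p, v). (F u, concat (map g p), F v))"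
  have F_in: "F ks \<in> admissible_seqs \<nu>2 ex2 B2" if "ks \<in> admissible_seqs \<nu>1 ex1 B1" for ks
    unfolding F_def using that assms(2,3,7) by (rule F_seq_in_admissible_seqs)
  have phi_in: "\<phi>' ks (Some k) \<in> adj0 (mut_set \<nu>2 B2 (F ks) ex2)"
    if "ks \<in> admissible_seqs \<nu>1 ex1 B1" "k \<in> mut_set \<nu>1 B1 ks ex1" for ks k
    unfolding \<phi>'_def phi_seq_def F_def [symmetric]
    using that(1) assms(2,3) F_in [OF that(1)] assms(7) that(2) by (rule conj_map_in_adj0_mut_set)
  have F_None: "F (k # ks) = F ks" if "\<phi>' ks (Some k) = None" for k ks
    using that by (auto simp: F_def \<phi>'_def phi_seq_def Let_def)
  have F_Some: "F (k # ks) = l # F ks"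
    if "\<phi>' ks (Some k) = Some l" "l \<in> mut_set \<nu>2 B2 (F ks) ex2" for k ks l
    using that by (auto simp: F_def \<phi>'_def phi_seq_def Let_def)
  have "is_functor (path_category ?G) (path_category ?H) F Fm"
    unfolding Fm_def
  proof (rule is_functor_path_category)
    fix e assume "e \<in> arcs ?G"
    then obtain k ks where e: "e = (k, ks)"
      and ks: "ks \<in> admissible_seqs \<nu>1 ex1 B1" and k: "k \<in> mut_set \<nu>1 B1 ks ex1"
      by (auto simp: exchange_tree_def)
    \<comment> \<open>The recursion for \<open>F\<close> makes the same case split as
      \<open>g\<close>, so the endpoint \<open>F (k # ks)\<close> is either \<open>F ks\<close>
      itself or \<open>l # F ks\<close>.\<close>
    have "H.awalk (F ks) (g e) (F (k # ks))"
    proof (cases "\<phi>' ks (Some k)")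
      case None
      then show ?thesis
        using F_in [OF ks] by (simp add: e g_def F_None H.awalk_Nil_iff) (simp add: exchange_tree_def)
    next
      case (Some l)
      with phi_in [OF ks k] have l: "l \<in> mut_set \<nu>2 B2 (F ks) ex2"
        by (auto simp: adj0_def)
      have "(l, F ks) \<in> arcs ?H"
        using F_in [OF ks] l by (simp add: exchange_tree_def)
      from H.arc_implies_awalk [OF this] show ?thesis
        using Some l by (simp add: e g_def F_Some) (simp add: exchange_tree_def)
    qed
    then show "H.awalk (F (tail ?G e)) (g e) (F (head ?G e))"
      by (simp add: e exchange_tree_def)
  next
    fix u assume "u \<in> verts ?G"
    then show "F u \<in> verts ?H" using F_in by (simp add: exchange_tree_def)
  qed (rule wf_digraph_exchange_tree)+
  \<comment> \<open>A generating arrow is a one-arc path, so the concatenation reduces to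
    \<open>g (k, ks)\<close>. In the case of 0 it is empty and \<open>F_None\<close> equates the two
    ends, giving the identity.\<close>
  moreover have "Fm (mut_arrow \<nu>1 ex1 B1 k ks) = mut_arrow \<nu>2 ex2 B2 l (F ks)"
    if "\<phi>' ks (Some k) = Some l" "l \<in> mut_set \<nu>2 B2 (F ks) ex2" for k ks l
    using that by (simp add: Fm_def g_def mut_arrow_def arc_path_def exchange_tree_def F_Some)
  moreover have "Fm (mut_arrow \<nu>1 ex1 B1 k ks) = Ident (path_category ?H) (F ks)"
    if "\<phi>' ks (Some k) = None" for k ks
    using that by (simp add: Fm_def g_def mut_arrow_def arc_path_def exchange_tree_def F_None)
  ultimately show ?thesis
    using phi_in by blast
qed

end
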